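(* Let $K>0$ and $\theta\in(-\pi/4,\pi/4]$ with $Ke^{i\theta}\in U$, and for $c\in\mathbb{C}$ let $f_c=g_c\circ h_{K,\theta}$, where $g_c(z)=z^2+c$. Then $$\mathcal{M}_{K,\theta}=\{c\in\mathbb{C}:\partial I(f_c)\text{ is connected}\}.$$
   Context: For $K>0$ and $\theta\in\mathbb{R}$, $h_{K,\theta}:\mathbb{C}\to\mathbb{C}$ is the affine stretch $h_{K,\theta}(z)=\left(\frac{K+1}{2}\right)z+e^{2i\theta}\left(\frac{K-1}{2}\right)\overline{z}$. The set $U$ is $$U=\{0<|z|<1,\ -\pi/4<\arg(z)\le \pi/4\}\cup\{|z|>1,\ -\pi/4<\arg(z)\le\pi/4\}\cup\{1\}\subset\mathbb{C}.$$ The escaping set of $f:\mathbb{C}\to\mathbb{C}$ is $I(f)=\{z\in\mathbb{C}: f^{n}(z)\to\infty\}$, where $f^n$ is the $n$-th iterate, and $\partial I(f)$ is its boundary in $\mathbb{C}$. The $(K,\theta)$-Mandelbrot set $\mathcal{M}_{K,\theta}$ is the set of those $c\in\mathbb{C}$ for which $0\notin I(f_c)$. *)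

theory Defs
  imports "HOL-Analysis.Analysis"
begin

definition h_stretch :: "real \<Rightarrow> real \<Rightarrow> complex \<Rightarrow> complex" where
  "h_stretch K \<theta> z =
     of_real ((K + 1) / 2) * z + exp (2 * \<i> * of_real \<theta>) * of_real ((K - 1) / 2) * cnj z"

definition g_quad :: "complex \<Rightarrow> complex \<Rightarrow> complex" where
  "g_quad c z = z\<^sup>2 + c"

definition f_map :: "real \<Rightarrow> real \<Rightarrow> complex \<Rightarrow> complex \<Rightarrow> complex" where
  "f_map K \<theta> c = g_quad c \<circ> h_stretch K \<theta>"

text \<open>\<open>Arg\<close> is the principal argument, with values in the interval from \<open>-pi\<close> (excluded)
  to \<open>pi\<close> (included).\<close>

definition U_set :: "complex set" where
  "U_set = {z. 0 < norm z \<and> norm z < 1 \<and> - pi / 4 < Arg z \<and> Arg z \<le> pi / 4}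
         \<union> {z. norm z > 1 \<and> - pi / 4 < Arg z \<and> Arg z \<le> pi / 4}
         \<union> {1}"

definition escaping_set :: "(complex \<Rightarrow> complex) \<Rightarrow> complex set" where
  "escaping_set f = {z. filterlim (\<lambda>n. (f ^^ n) z) at_infinity sequentially}"

definition mandelbrot_set :: "real \<Rightarrow> real \<Rightarrow> complex set" where
  "mandelbrot_set K \<theta> = {c. 0 \<notin> escaping_set (f_map K \<theta> c)}"

end

theory Submission
  imports Defs "HOL-Complex_Analysis.Conformal_Mappings"
begin

text \<open>
  Write \<open>f = h\<^sup>2 + c\<close> with \<open>h\<close> an invertible real-linear map, let \<open>I\<close> be the escaping set and
  \<open>X\<close> its frontier. Like a quadratic polynomial, \<open>f\<close> is a continuous open surjection of the plane
  that is two-to-one except over its critical value \<open>c = f 0\<close>, and it at least doubles the norm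
  outside some disc. Since \<open>I\<close> is completely invariant, \<open>0 \<in> I\<close> exactly when \<open>c \<in> I\<close>.

  The set \<open>I\<close> is always open and connected: on a bounded component the iterates would obey a maximum
  principle, which open maps satisfy, and so they would stay bounded there
  (\<open>connected_escaping_set\<close>).

  If \<open>c\<close> does not escape, then \<open>- I\<close> is the decreasing intersection of the preimages of a large
  disc under the iterates. Each of these contains \<open>c\<close>. The preimage of a connected set containing
  \<open>c\<close> is connected, because every clopen piece of it maps onto the whole set and therefore contains
  the only point over \<open>c\<close> (\<open>connected_vimage_open_map\<close>). Hence \<open>- I\<close> is connected, and two
  complementary connected sets in the plane have a connected common frontier.

  If \<open>c\<close> escapes, it lies in the unbounded component of \<open>- X\<close>, because \<open>I\<close> is connected. So \<open>X\<close> does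
  not wind around \<open>c\<close> and \<open>z - c\<close> has a continuous square root \<open>s\<close> on \<open>X\<close>
  (\<open>continuous_sqrt_unbounded_complement_component\<close>). On \<open>X\<close>, which is invariant under \<open>f\<close> and
  under \<open>z \<mapsto> - z\<close>, the quotient \<open>h z / s (f z)\<close> is continuous, takes only the values \<open>1\<close> and
  \<open>- 1\<close>, and is odd. It is thus nonconstant on the nonempty set \<open>X\<close>, which must be disconnected.
\<close>

section \<open>Topological preliminaries\<close>

text \<open>
  Compactness of the preimage makes the restriction of \<open>f\<close> to a clopen piece of it closed as well as
  open, so every nonempty piece covers all of \<open>A\<close>. Two disjoint pieces cannot both contain the single
  point over \<open>v\<close>.
\<close>
lemma connected_vimage_open_map:
  fixes f :: "'a::real_normed_vector \<Rightarrow> 'b::real_normed_vector"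
  assumes cont: "continuous_on UNIV f"
    and opn: "\<And>U. open U \<Longrightarrow> open (f ` U)"
    and comp: "compact (f -` A)" and conn: "connected A"
    and fibre: "f -` {v} = {p}" and v: "v \<in> A"
  shows "connected (f -` A)"
proof (rule ccontr)
  assume "\<not> connected (f -` A)"
  then obtain S T where op: "open S" "open T" and cov: "f -` A \<subseteq> S \<union> T"
    and disj: "S \<inter> T \<inter> f -` A = {}" and ne: "S \<inter> f -` A \<noteq> {}" "T \<inter> f -` A \<noteq> {}"
    by (auto simp: connected_def)
  have full: "p \<in> W \<inter> f -` A"
    if W: "open W" "open W'" "f -` A \<subseteq> W \<union> W'" "W \<inter> W' \<inter> f -` A = {}" "W \<inter> f -` A \<noteq> {}" for W W'
  proof -
    let ?P = "W \<inter> f -` A"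
    have eq: "?P = f -` A - W'" using W by blast
    have "compact ?P"
      unfolding eq using comp W(2) by (rule compact_diff)
    then have "closed (f ` ?P)"
      by (meson compact_continuous_image compact_imp_closed cont continuous_on_subset subset_UNIV)
    moreover have "f ` ?P = A \<inter> f ` W" by auto
    ultimately have "closedin (top_of_set A) (f ` ?P)" "openin (top_of_set A) (f ` ?P)"
      using opn[OF W(1)] by (auto intro: closed_subset openin_open_Int)
    then have "f ` ?P = A"
      using conn W(5) by (metis connected_clopen image_is_empty)
    then have "v \<in> f ` ?P" using v by simp
    then obtain x where x: "x \<in> ?P" "v = f x" by (elim imageE)
    then have "x \<in> f -` {v}" by simp
    then have "x = p" unfolding fibre by simp
    with x(1) show ?thesis by simp
  qed
  have "p \<in> S \<inter> f -` A" using full[OF op cov disj ne(1)] .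
  moreover have "p \<in> T \<inter> f -` A" using full[OF op(2,1) _ _ ne(2)] cov disj by blast
  ultimately show False using disj by blast
qed

text \<open>
  The maximum principle needs only openness: the image of a neighbourhood of a point contains values
  of larger norm, so the maximum over the compact closure is attained on the frontier.
\<close>
lemma norm_open_map_le_frontier_bound:
  fixes f :: "'a::euclidean_space \<Rightarrow> 'b::{real_normed_vector, perfect_space}"
  assumes cont: "continuous_on UNIV f"
    and opn: "\<And>U. open U \<Longrightarrow> open (f ` U)"
    and V: "open V" "bounded V"
    and bd: "\<And>z. z \<in> frontier V \<Longrightarrow> norm (f z) \<le> R"
    and z: "z \<in> V"
  shows "norm (f z) \<le> R"
proof -
  have "compact (closure V)" "closure V \<noteq> {}" using V z by (auto simp: closure_subset)
  moreover have "continuous_on (closure V) (\<lambda>z. norm (f z))"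
    by (intro continuous_on_norm continuous_on_subset[OF cont]) auto
  ultimately obtain w where w: "w \<in> closure V" "\<And>y. y \<in> closure V \<Longrightarrow> norm (f y) \<le> norm (f w)"
    using continuous_attains_sup by metis
  have "w \<notin> V"
  proof
    assume "w \<in> V"
    then obtain e where e: "e > 0" "cball (f w) e \<subseteq> f ` V"
      using opn[OF V(1)] by (meson image_eqI open_contains_cball)
    \<comment> \<open>Moving the value \<open>f w\<close> radially outwards by \<open>e\<close> stays inside the image of \<open>V\<close>.\<close>
    obtain u :: 'b where u: "norm u = 1" "f w = norm (f w) *\<^sub>R u"
    proof (cases "f w = 0")
      case True
      obtain x :: 'b where "norm x = 1" using vector_choose_size[of 1] by auto
      then show ?thesis using that[of x] True by simp
    next
      case False
      then show ?thesis using that[of "sgn (f w)"] by (simp add: norm_sgn sgn_div_norm)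
    qed
    have "f w + e *\<^sub>R u \<in> cball (f w) e" using e u(1) by (simp add: dist_norm)
    then obtain y where y: "y \<in> V" "f y = f w + e *\<^sub>R u" using e(2) by (metis imageE subsetD)
    have "f y = (norm (f w) + e) *\<^sub>R u" using u(2) y(2) by (metis scaleR_add_left)
    then have "norm (f y) = norm (f w) + e" using e(1) u(1) by simp
    moreover have "norm (f y) \<le> norm (f w)" using w(2) y(1) closure_subset by blast
    ultimately show False using e(1) by simp
  qed
  then have "norm (f w) \<le> R" using bd w(1) V(1) by (simp add: frontier_def interior_open)
  then show ?thesis using w(2)[of z] z closure_subset by fastforce
qed

text \<open>
  By Borsuk's criterion, a point \<open>a\<close> that can be moved to infinity off \<open>S\<close> is one for which the direction
  from \<open>a\<close> is a null-homotopic map from \<open>S\<close> into the circle. Its argument then has a continuous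
  choice on \<open>S\<close>, which can be halved.
\<close>
lemma continuous_sqrt_unbounded_complement_component:
  fixes a :: complex
  assumes S: "compact S" "a \<notin> S"
    and unb: "\<not> bounded (connected_component_set (- S) a)"
  obtains s where "continuous_on S s" "\<And>x. x \<in> S \<Longrightarrow> (s x)\<^sup>2 = x - a"
proof -
  obtain u where "homotopic_with_canon (\<lambda>x. True) S (sphere 0 1)
                    (\<lambda>x. inverse (norm (x - a)) *\<^sub>R (x - a)) (\<lambda>x. u)"
    using Borsuk_map_essential_bounded_component[OF S] unb by blast
  then obtain g where g: "continuous_on S g"
    "\<And>x. x \<in> S \<Longrightarrow> inverse (norm (x - a)) *\<^sub>R (x - a) = exp (\<i> * of_real (g x))"
    using inessential_eq_continuous_logarithm_circle
      [of S "\<lambda>x. inverse (norm (x - a)) *\<^sub>R (x - a)"] by blast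
  let ?s = "\<lambda>x. of_real (sqrt (norm (x - a))) * exp (\<i> * of_real (g x) / 2)"
  show thesis
  proof
    show "continuous_on S ?s" using g(1) by (intro continuous_intros) auto
    fix x assume x: "x \<in> S"
    have "(?s x)\<^sup>2 = of_real ((sqrt (norm (x - a)))\<^sup>2) * exp (\<i> * of_real (g x))"
      by (simp add: power_mult_distrib flip: exp_double of_real_power)
    also have "\<dots> = of_real (norm (x - a)) * (inverse (norm (x - a)) *\<^sub>R (x - a))"
      using g(2)[OF x] by simp
    also have "\<dots> = x - a"
    proof -
      have "norm (x - a) \<noteq> 0" using x S(2) by auto
      then show ?thesis by (simp add: scaleR_conv_of_real flip: mult.assoc of_real_inverse of_real_mult)
    qed
    finally show "(?s x)\<^sup>2 = x - a" .
  qed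
qed

lemma continuous_maps_frontier_into_frontier:
  assumes "continuous_on UNIV g" "open S" "\<And>z. g z \<in> S \<longleftrightarrow> z \<in> S" "z \<in> frontier S"
  shows "g z \<in> frontier S"
proof -
  have "g ` closure S \<subseteq> closure S"
    using assms(3) closure_subset
    by (intro image_closure_subset continuous_on_subset[OF assms(1)]) auto
  then show ?thesis using assms by (auto simp: frontier_def interior_open)
qed

section \<open>Escape to infinity\<close>

text \<open>
  Doubling outside the disc makes escaping the same as leaving the disc once. This finite-time condition
  is what turns continuity and openness of the iterates into properties of the escaping set.
\<close>
locale escape_radius =
  fixes f :: "complex \<Rightarrow> complex" and R :: real
  assumes cont: "continuous_on UNIV f"
    and open_map: "open U \<Longrightarrow> open (f ` U)"
    and surj: "surj f"
    and R_pos: "R > 0"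
    and doubling: "R < norm z \<Longrightarrow> 2 * norm z \<le> norm (f z)"
begin

lemma cont_funpow: "continuous_on UNIV (f ^^ n)"
proof (induction n)
  case (Suc n)
  then show ?case
    using continuous_on_compose[of UNIV "f ^^ n" f] continuous_on_subset[OF cont] by simp
qed (simp add: id_def)

lemma open_map_funpow: "open U \<Longrightarrow> open ((f ^^ n) ` U)"
proof (induction n)
  case (Suc n)
  then have "open (f ` (f ^^ n) ` U)" by (simp add: open_map del: image_image)
  then show ?case by (simp add: image_image)
qed simp

lemma norm_funpow_ge:
  assumes "R < norm z"
  shows "2 ^ n * norm z \<le> norm ((f ^^ n) z)"
proof (induction n)
  case (Suc n)
  have "norm z \<le> 2 ^ n * norm z" by (simp add: mult_le_cancel_right1)
  with Suc assms have "R < norm ((f ^^ n) z)" by linarith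
  from doubling[OF this] Suc show ?case by simp
qed simp

lemma escaping_set_image_iff: "f z \<in> escaping_set f \<longleftrightarrow> z \<in> escaping_set f"
  using filterlim_sequentially_Suc[of "\<lambda>n. (f ^^ n) z" at_infinity]
  by (simp add: escaping_set_def funpow_swap1)

lemma escaping_set_funpow_iff: "(f ^^ k) z \<in> escaping_set f \<longleftrightarrow> z \<in> escaping_set f"
  by (induction k) (simp_all add: escaping_set_image_iff)

lemma escaping_set_if_large:
  assumes "R < norm z"
  shows "z \<in> escaping_set f"
proof -
  have "filterlim (\<lambda>n. 2 ^ n * r) at_top sequentially" if "r > 0" for r :: real
    using that by real_asymp
  then have "filterlim (\<lambda>n. 2 ^ n * norm z) at_top sequentially"
    using assms R_pos by (meson less_trans)
  then have "filterlim (\<lambda>n. norm ((f ^^ n) z)) at_top sequentially"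
    by (rule filterlim_at_top_mono) (use norm_funpow_ge[OF assms] in simp)
  then show ?thesis
    unfolding escaping_set_def by (simp add: filterlim_norm_at_top_imp_at_infinity)
qed

lemma escaping_set_iff: "z \<in> escaping_set f \<longleftrightarrow> (\<exists>n. R < norm ((f ^^ n) z))"
proof
  assume "z \<in> escaping_set f"
  then have "filterlim (\<lambda>n. norm ((f ^^ n) z)) at_top sequentially"
    unfolding escaping_set_def by (auto intro: filterlim_at_infinity_imp_norm_at_top)
  then have "\<forall>\<^sub>F n in sequentially. R < norm ((f ^^ n) z)"
    by (simp add: filterlim_at_top_dense)
  then show "\<exists>n. R < norm ((f ^^ n) z)"
    by (auto simp: eventually_sequentially)
next
  assume "\<exists>n. R < norm ((f ^^ n) z)"
  then show "z \<in> escaping_set f"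
    using escaping_set_if_large escaping_set_funpow_iff by blast
qed

lemma open_escaping_set: "open (escaping_set f)"
proof -
  have "escaping_set f = (\<Union>n. {z. R < norm ((f ^^ n) z)})"
    using escaping_set_iff by blast
  moreover have "open {z. R < norm ((f ^^ n) z)}" for n
    by (intro open_Collect_less continuous_intros cont_funpow)
  ultimately show ?thesis by auto
qed

text \<open>
  The points whose \<open>n\<close>-th iterate has not left the disc. By the doubling condition an orbit that has
  left never comes back, so these sets decrease.
\<close>
definition level :: "nat \<Rightarrow> complex set" where
  "level n = (f ^^ n) -` cball 0 R"

lemma compl_escaping_set: "- escaping_set f = (\<Inter>n. level n)"
  by (simp add: set_eq_iff escaping_set_iff level_def not_less)

lemma level_Suc: "level (Suc n) = f -` level n"
  by (auto simp: level_def funpow_swap1)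

lemma level_Suc_subset: "level (Suc n) \<subseteq> level n"
proof
  fix z assume z: "z \<in> level (Suc n)"
  show "z \<in> level n"
  proof (rule ccontr)
    assume "z \<notin> level n"
    then have "R < norm ((f ^^ n) z)" by (simp add: level_def)
    from doubling[OF this] this z R_pos show False by (simp add: level_def)
  qed
qed

lemma level_antimono: "m \<le> n \<Longrightarrow> level n \<subseteq> level m"
  using level_Suc_subset by (rule lift_Suc_antimono_le)

lemma compact_level: "compact (level n)"
proof -
  have "closed (level n)"
    unfolding level_def using cont_funpow by (intro closed_vimage) auto
  moreover have "level n \<subseteq> cball 0 R"
    using level_antimono[of 0 n] by (simp add: level_def)
  ultimately show ?thesis
    by (meson bounded_cball bounded_subset compact_eq_bounded_closed)
qed

lemma compl_escaping_set_nonempty: "- escaping_set f \<noteq> {}"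
proof -
  have "level n \<noteq> {}" for n
  proof (induction n)
    case 0
    then show ?case using R_pos by (simp add: level_def)
  next
    case (Suc n)
    then show ?case using surj unfolding level_Suc by (metis surj_image_vimage_eq image_empty)
  qed
  then show ?thesis
    unfolding compl_escaping_set
    by (intro compact_nest compact_level level_antimono)
qed

lemma frontier_escaping_set_subset: "frontier (escaping_set f) \<subseteq> - escaping_set f"
  using open_escaping_set by (auto simp: frontier_def interior_open)

lemma compact_frontier_escaping_set: "compact (frontier (escaping_set f))"
proof -
  have "frontier (escaping_set f) \<subseteq> level 0"
    using frontier_escaping_set_subset compl_escaping_set by blast
  then show ?thesis
    using compact_level frontier_closed compact_Int_closed inf.absorb2 by metis
qed

lemma frontier_escaping_set_nonempty: "frontier (escaping_set f) \<noteq> {}"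
proof -
  have "complex_of_real (R + 1) \<in> escaping_set f"
    using R_pos by (intro escaping_set_if_large) (simp del: of_real_add)
  then show ?thesis
    using compl_escaping_set_nonempty frontier_not_empty by blast
qed

text \<open>
  A component of the escaping set that missed the exterior of the disc would be bounded. Frontier points
  of a component do not escape, so all iterates are bounded by \<open>R\<close> there, and by the maximum
  principle on the component too; yet its points escape.
\<close>
lemma exterior_subset_component:
  assumes "z \<in> escaping_set f"
  shows "- cball 0 R \<subseteq> connected_component_set (escaping_set f) z"
proof -
  let ?V = "connected_component_set (escaping_set f) z"
  have ext: "- cball 0 R \<subseteq> escaping_set f" "connected (- cball (0::complex) R)"
    using escaping_set_if_large by (auto intro: connected_complement_bounded_convex)
  have "?V \<inter> - cball 0 R \<noteq> {}"
  proof
    assume "?V \<inter> - cball 0 R = {}"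
    then have "?V \<subseteq> cball 0 R" by blast
    then have bdd: "bounded ?V" using bounded_cball bounded_subset by blast
    have V: "open ?V" using open_escaping_set by (rule open_connected_component)
    obtain n where n: "R < norm ((f ^^ n) z)" using assms escaping_set_iff by blast
    have "norm ((f ^^ n) w) \<le> R" if "w \<in> frontier ?V" for w
    proof -
      have "w \<notin> escaping_set f"
        using that frontier_of_connected_component_subset[of "escaping_set f" z]
          frontier_escaping_set_subset by blast
      then show ?thesis using escaping_set_iff not_less by blast
    qed
    then have "norm ((f ^^ n) z) \<le> R"
      using norm_open_map_le_frontier_bound[OF cont_funpow open_map_funpow V bdd] assms
      by (metis connected_component_refl mem_Collect_eq)
    with n show False by simp
  qed
  then obtain w where w: "w \<in> ?V" "w \<in> - cball 0 R" by blast
  have "- cball 0 R \<subseteq> connected_component_set (escaping_set f) w"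
    using connected_component_maximal w(2) ext by blast
  then show ?thesis using connected_component_eq[OF w(1)] by simp
qed

lemma connected_escaping_set: "connected (escaping_set f)"
proof -
  have "complex_of_real (R + 1) \<in> - cball 0 R" using R_pos by (simp del: of_real_add)
  then have "connected_component (escaping_set f) z (of_real (R + 1))" if "z \<in> escaping_set f" for z
    using exterior_subset_component[OF that] by blast
  then show ?thesis
    unfolding connected_iff_connected_component
    by (meson connected_component_sym connected_component_trans)
qed

text \<open>
  As \<open>v\<close> lies in every level, its single preimage point glues each level together, starting from the
  disc at level \<open>0\<close>.
\<close>
lemma connected_frontier_if_ramified_value_bounded:
  assumes "f -` {v} = {p}" "v \<notin> escaping_set f"
  shows "connected (frontier (escaping_set f))"
proof -
  have v: "v \<in> level n" for n using assms(2) compl_escaping_set by blast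
  have "connected (level n)" for n
  proof (induction n)
    case 0
    then show ?case by (simp add: level_def)
  next
    case (Suc n)
    then show ?case
      using connected_vimage_open_map[OF cont open_map _ _ assms(1) v]
        compact_level[of "Suc n"] unfolding level_Suc by blast
  qed
  then have "connected (- escaping_set f)"
    unfolding compl_escaping_set by (intro connected_nest compact_level level_antimono)
  then show ?thesis using connected_frontier_simple connected_escaping_set by blast
qed

text \<open>
  Over a connected frontier, \<open>h\<close> would agree up to a constant sign with \<open>s \<circ> f\<close>, where \<open>s\<close> is a
  continuous square root of \<open>z - v\<close>. This contradicts symmetry: \<open>h\<close> is odd and \<open>f\<close> is even.
\<close>
lemma disconnected_frontier_if_ramified_value_escapes:
  assumes h: "continuous_on UNIV h" "\<And>z. h (- z) = - h z"
    and f: "\<And>z. f z = (h z)\<^sup>2 + v" and v: "v \<in> escaping_set f"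
  shows "\<not> connected (frontier (escaping_set f))"
proof
  let ?X = "frontier (escaping_set f)"
  assume conn: "connected ?X"
  have "v \<notin> ?X" using v frontier_escaping_set_subset by (meson ComplD subsetD)
  moreover have "\<not> bounded (connected_component_set (- ?X) v)"
  proof
    assume "bounded (connected_component_set (- ?X) v)"
    moreover have "- cball 0 R \<subseteq> connected_component_set (- ?X) v"
    proof (rule subset_trans)
      show "- cball 0 R \<subseteq> connected_component_set (escaping_set f) v"
        using v by (rule exterior_subset_component)
      show "connected_component_set (escaping_set f) v \<subseteq> connected_component_set (- ?X) v"
        using frontier_escaping_set_subset by (intro connected_component_mono) blast
    qed
    ultimately have "bounded (- cball (0::complex) R)" by (rule bounded_subset)
    then show False
      using cobounded_imp_unbounded[of "- cball (0::complex) R"] by simp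
  qed
  ultimately obtain s where s: "continuous_on ?X s" "\<And>x. x \<in> ?X \<Longrightarrow> (s x)\<^sup>2 = x - v"
    by (rule continuous_sqrt_unbounded_complement_component[OF compact_frontier_escaping_set])
      (rule that, assumption)
  have f_X: "f w \<in> ?X" if "w \<in> ?X" for w
    using cont open_escaping_set escaping_set_image_iff that
    by (rule continuous_maps_frontier_into_frontier)
  have even: "f (- w) = f w" for w by (simp add: f h(2))
  have neg_X: "- w \<in> ?X" if "w \<in> ?X" for w
  proof (rule continuous_maps_frontier_into_frontier[of uminus])
    show "- z \<in> escaping_set f \<longleftrightarrow> z \<in> escaping_set f" for z
      using escaping_set_image_iff[of z] escaping_set_image_iff[of "- z"] even by simp
    show "continuous_on UNIV (uminus :: complex \<Rightarrow> complex)"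
      by (intro continuous_intros)
  qed (use that open_escaping_set in auto)
  define q where "q w = h w / s (f w)" for w
  have sq: "(s (f w))\<^sup>2 = (h w)\<^sup>2" "s (f w) \<noteq> 0" if "w \<in> ?X" for w
  proof -
    show *: "(s (f w))\<^sup>2 = (h w)\<^sup>2" using s(2)[OF f_X[OF that]] f by simp
    have "f w \<noteq> v" using f_X[OF that] \<open>v \<notin> ?X\<close> by auto
    then show "s (f w) \<noteq> 0" using * f by auto
  qed
  have "continuous_on ?X (s \<circ> f)"
    using s(1) f_X continuous_on_subset[OF cont]
    by (intro continuous_on_compose) (auto intro: continuous_on_subset)
  then have "continuous_on ?X q"
    unfolding q_def using sq(2) continuous_on_subset[OF h(1)]
    by (intro continuous_on_divide) (auto simp: o_def)
  moreover have "q ` ?X \<subseteq> {1, - 1}"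
  proof
    fix y assume "y \<in> q ` ?X"
    then obtain w where w: "w \<in> ?X" "y = q w" by (elim imageE)
    have "(h w)\<^sup>2 \<noteq> 0" using sq[OF w(1)] by (metis power_not_zero)
    then have "y\<^sup>2 = 1" using sq(1)[OF w(1)] w(2) by (simp add: q_def power_divide)
    then show "y \<in> {1, - 1}" by (simp add: power2_eq_1_iff)
  qed
  ultimately have "q constant_on ?X"
    using continuous_finite_range_constant[OF conn] finite_subset[of "q ` ?X" "{1, - 1}"] by simp
  moreover obtain w where w: "w \<in> ?X"
    using frontier_escaping_set_nonempty by (meson ex_in_conv)
  ultimately have "q (- w) = q w" using neg_X[OF w] w unfolding constant_on_def by metis
  moreover have "q (- w) = - q w" by (simp add: q_def even h(2))
  moreover have "q w \<noteq> 0" using sq[OF w] by (auto simp: q_def)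
  ultimately show False by simp
qed

end

section \<open>Squaring after an invertible real-linear map\<close>

lemma escape_radius_square_linear:
  fixes h :: "complex \<Rightarrow> complex"
  assumes lin: "linear h" and inj: "inj h"
  obtains R where "escape_radius (\<lambda>z. (h z)\<^sup>2 + c) R"
proof -
  obtain m where m: "m > 0" "\<And>z. m * norm z \<le> norm (h z)"
    using linear_inj_bounded_below_pos[OF lin inj] by (metis mult.commute)
  have surj: "surj h" using linear_inj_imp_surj[OF lin inj] .
  have conth: "continuous_on UNIV h" by (simp add: lin linear_continuous_on linear_linear)
  \<comment> \<open>Beyond \<open>3 / m\<^sup>2\<close> the squared term has norm at least \<open>3 * norm z\<close>; beyond \<open>norm c\<close> adding
      \<open>c\<close> costs at most one of these three. The summand \<open>1\<close> keeps \<open>R\<close> positive.\<close>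
  define R where "R = max (1 + norm c) (3 / m\<^sup>2)"
  have R1: "1 + norm c \<le> R" and R2: "3 / m\<^sup>2 \<le> R" by (auto simp: R_def)
  show thesis
  proof
    show "escape_radius (\<lambda>z. (h z)\<^sup>2 + c) R"
    proof
      show "continuous_on UNIV (\<lambda>z. (h z)\<^sup>2 + c)"
        using conth by (intro continuous_intros)
    next
      fix U :: "complex set" assume "open U"
      then have "open (h ` U)" using open_surjective_linear_image lin surj by blast
      moreover have "\<not> (\<lambda>w::complex. w\<^sup>2 + c) constant_on UNIV"
      proof
        assume "(\<lambda>w::complex. w\<^sup>2 + c) constant_on UNIV"
        then have "(0::complex)\<^sup>2 + c = 1\<^sup>2 + c" unfolding constant_on_def by (metis UNIV_I)
        then show False by simp
      qed
      moreover have "(\<lambda>w. w\<^sup>2 + c) holomorphic_on UNIV" by (intro holomorphic_intros)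
      ultimately have "open ((\<lambda>w. w\<^sup>2 + c) ` (h ` U))"
        using open_mapping_thm[of "\<lambda>w. w\<^sup>2 + c" UNIV "h ` U"] by (simp add: connected_UNIV)
      then show "open ((\<lambda>z. (h z)\<^sup>2 + c) ` U)" by (simp add: image_image)
    next
      have "\<exists>z. y = (h z)\<^sup>2 + c" for y
        using surjD[OF surj, of "csqrt (y - c)"] power2_csqrt[of "y - c"]
        by (metis diff_add_cancel)
      then show "surj (\<lambda>z. (h z)\<^sup>2 + c)" by (simp add: surj_def)
    next
      show "R > 0" using R1 norm_ge_zero[of c] by linarith
    next
      fix z :: complex assume z: "R < norm z"
      have "3 / m\<^sup>2 \<le> norm z" using R2 z by linarith
      then have "3 \<le> m\<^sup>2 * norm z" using m(1) by (simp add: field_simps)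
      then have "3 * norm z \<le> m\<^sup>2 * norm z * norm z" by (simp add: mult_right_mono)
      also have "\<dots> = (m * norm z)\<^sup>2" by (simp add: power2_eq_square)
      also have "\<dots> \<le> (norm (h z))\<^sup>2" using m by (intro power_mono) auto
      finally have "3 * norm z \<le> norm ((h z)\<^sup>2)" by (simp add: norm_power)
      moreover have "norm ((h z)\<^sup>2) - norm c \<le> norm ((h z)\<^sup>2 + c)" by (rule norm_diff_ineq)
      ultimately show "2 * norm z \<le> norm ((h z)\<^sup>2 + c)" using R1 z by linarith
    qed
  qed
qed

text \<open>
  The critical point is \<open>0\<close> and \<open>c\<close> is its value, so the two alternatives for \<open>c\<close> treated above are
  the two alternatives for \<open>0\<close>.
\<close>
theorem connected_frontier_escaping_set_iff:
  fixes h :: "complex \<Rightarrow> complex" and c :: complex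
  assumes lin: "linear h" and inj: "inj h"
  defines "f \<equiv> \<lambda>z. (h z)\<^sup>2 + c"
  shows "connected (frontier (escaping_set f)) \<longleftrightarrow> 0 \<notin> escaping_set f"
proof -
  obtain R where "escape_radius f R"
    unfolding f_def using escape_radius_square_linear[OF lin inj] by blast
  then interpret escape_radius f R .
  have h0: "h z = 0 \<longleftrightarrow> z = 0" for z
    using linear_injective_0[OF lin] inj linear_0[OF lin] by metis
  have fibre: "f -` {c} = {0}" by (auto simp: f_def h0)
  have conth: "continuous_on UNIV h" by (simp add: lin linear_continuous_on linear_linear)
  have "f 0 = c" using h0 by (simp add: f_def)
  then have "0 \<in> escaping_set f \<longleftrightarrow> c \<in> escaping_set f"
    using escaping_set_image_iff[of 0] by simp
  moreover have "f z = (h z)\<^sup>2 + c" for z by (simp add: f_def)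
  ultimately show ?thesis
    using connected_frontier_if_ramified_value_bounded[OF fibre]
      disconnected_frontier_if_ramified_value_escapes[OF conth linear_neg[OF lin], of c]
    by metis
qed

lemma linear_h_stretch: "linear (h_stretch K \<theta>)"
proof (rule linearI)
  fix y z
  show "h_stretch K \<theta> (y + z) = h_stretch K \<theta> y + h_stretch K \<theta> z"
    by (simp only: h_stretch_def complex_cnj_add distrib_left add_ac)
qed (simp add: h_stretch_def scaleR_conv_of_real algebra_simps)

text \<open>
  On the kernel the complex-linear part and the conjugate-linear part have equal norms. These are
  \<open>norm z\<close> multiplied by \<open>\<bar>K + 1\<bar> / 2\<close> and \<open>\<bar>K - 1\<bar> / 2\<close>, which differ unless \<open>K = 0\<close>.
\<close>
lemma inj_h_stretch:
  assumes "K > 0"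
  shows "inj (h_stretch K \<theta>)"
proof -
  have "z = 0" if "h_stretch K \<theta> z = 0" for z
  proof -
    have "of_real ((K + 1) / 2) * z = - (exp (2 * \<i> * of_real \<theta>) * of_real ((K - 1) / 2) * cnj z)"
      using that by (simp add: h_stretch_def add_eq_0_iff2)
    then have "norm (of_real ((K + 1) / 2) * z)
        = norm (exp (2 * \<i> * of_real \<theta>) * of_real ((K - 1) / 2) * cnj z)"
      by (metis norm_minus_cancel)
    then have "\<bar>(K + 1) / 2\<bar> * norm z = \<bar>(K - 1) / 2\<bar> * norm z"
      by (simp only: norm_mult norm_of_real complex_mod_cnj) simp
    moreover have "\<bar>(K + 1) / 2\<bar> \<noteq> \<bar>(K - 1) / 2\<bar>" using assms by (simp add: abs_if field_simps)
    ultimately show ?thesis by simp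
  qed
  then show ?thesis using linear_injective_0[OF linear_h_stretch] by blast
qed

theorem theorem6p2:
  fixes K \<theta> :: real
  assumes "K > 0"
    and "- pi / 4 < \<theta>" and "\<theta> \<le> pi / 4"
    and "of_real K * exp (\<i> * of_real \<theta>) \<in> U_set"
  shows "mandelbrot_set K \<theta> = {c. connected (frontier (escaping_set (f_map K \<theta> c)))}"
proof -
  have "f_map K \<theta> c = (\<lambda>z. (h_stretch K \<theta> z)\<^sup>2 + c)" for c
    by (simp add: f_map_def g_quad_def fun_eq_iff)
  then show ?thesis
    unfolding mandelbrot_set_def
    using connected_frontier_escaping_set_iff[OF linear_h_stretch inj_h_stretch[OF assms(1)]]
    by simp
qed

end
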